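(* Let $a,b\in\mathbb{R}$ with $a<b$, and let $F\colon [a,b]^2\to[a,b]$ be a reflexive, partially strictly increasing, symmetric and bisymmetric map. Then there is a continuous bijective function $f\colon [0,1]\to [a,b]$ such that $$F(x,y)=f\left(\frac{f^{-1}(x)+f^{-1}(y)}{2}\right)\qquad\text{for all } x,y\in[a,b].$$
   Context: Let $I\subseteq\mathbb{R}$ be an interval (here $I=[a,b]$) and $F\colon I^2\to I$ a map. $F$ is reflexive if $F(x,x)=x$ for every $x\in I$. $F$ is partially strictly increasing if for every fixed $x_0,y_0\in I$ the functions $x\mapsto F(x,y_0)$ and $y\mapsto F(x_0,y)$ are strictly increasing on $I$. $F$ is symmetric if $F(x,y)=F(y,x)$ for every $x,y\in I$. $F$ is bisymmetric if $F\big(F(x,y),F(u,v)\big)=F\big(F(x,u),F(y,v)\big)$ for every $x,y,u,v\in I$. No continuity of $F$ is assumed. *)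

theory Defs
  imports "HOL-Analysis.Analysis"
begin

(* A map from I x I to I is represented by a curried function on the whole real line that sends
   I x I into I; its values elsewhere are irrelevant, since every notion below only refers to
   arguments in I. *)

definition maps_square_into :: "real set \<Rightarrow> (real \<Rightarrow> real \<Rightarrow> real) \<Rightarrow> bool" where
  "maps_square_into I F \<longleftrightarrow> (\<forall>x\<in>I. \<forall>y\<in>I. F x y \<in> I)"

definition reflexive_map_on :: "real set \<Rightarrow> (real \<Rightarrow> real \<Rightarrow> real) \<Rightarrow> bool" where
  "reflexive_map_on I F \<longleftrightarrow> (\<forall>x\<in>I. F x x = x)"

definition partially_strict_mono_on :: "real set \<Rightarrow> (real \<Rightarrow> real \<Rightarrow> real) \<Rightarrow> bool" where
  "partially_strict_mono_on I F \<longleftrightarrow>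
     (\<forall>x0\<in>I. \<forall>y0\<in>I. strict_mono_on I (\<lambda>x. F x y0) \<and> strict_mono_on I (\<lambda>y. F x0 y))"

definition symmetric_map_on :: "real set \<Rightarrow> (real \<Rightarrow> real \<Rightarrow> real) \<Rightarrow> bool" where
  "symmetric_map_on I F \<longleftrightarrow> (\<forall>x\<in>I. \<forall>y\<in>I. F x y = F y x)"

definition bisymmetric_on :: "real set \<Rightarrow> (real \<Rightarrow> real \<Rightarrow> real) \<Rightarrow> bool" where
  "bisymmetric_on I F \<longleftrightarrow>
     (\<forall>x\<in>I. \<forall>y\<in>I. \<forall>u\<in>I. \<forall>v\<in>I. F (F x y) (F u v) = F (F x u) (F y v))"

end

theory Submission
  imports Defs
begin

text \<open>
  Bisymmetry makes the values of \<open>F\<close> iterated from the endpoints \<open>a\<close>, \<open>b\<close> into a strictly increasing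
  family indexed by the dyadic rationals of \<open>[0,1]\<close>, on which \<open>F\<close> is the arithmetic mean. Let \<open>g x\<close> be
  the supremum of the dyadic indices whose value is at most \<open>x\<close>. Squeezing between neighbouring dyadic
  values shows \<open>g (F x y) = (g x + g y) / 2\<close> for all \<open>x\<close>, \<open>y\<close>, and \<open>g\<close> is monotone onto \<open>[0,1]\<close>.
  If \<open>g x = g y\<close> with \<open>x < y\<close>, then for each \<open>z\<close> the map \<open>g\<close> is constant on the nondegenerate interval
  \<open>[F z x, F z y]\<close>, with value \<open>(g z + g x) / 2\<close>. Every such interval contains a rational, so \<open>g\<close>
  takes only countably many values, although it is onto \<open>[0,1]\<close>. Hence \<open>g\<close> is a monotone bijection,
  and its inverse is automatically continuous.
\<close>

section \<open>Real-analysis preliminaries\<close>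

text \<open>A monotone function can be discontinuous only through a jump, and a jump would leave a
  gap in the image interval.\<close>

lemma strict_mono_on_bij_betw_imp_continuous_on:
  fixes f :: "real \<Rightarrow> real"
  assumes mono: "strict_mono_on {c..d} f" and bij: "bij_betw f {c..d} {a..b}" and "c \<le> d"
  shows "continuous_on {c..d} f"
proof -
  have img: "f ` {c..d} = {a..b}"
    using bij by (rule bij_betw_imp_surj_on)
  have le: "f s \<le> f t" if "s \<in> {c..d}" "t \<in> {c..d}" "s \<le> t" for s t
    using mono that by (metis strict_mono_on_leD)
  have range: "f t \<in> {a..b}" if "t \<in> {c..d}" for t
    using img that by blast
  have "a \<le> b"
    using range[of c] \<open>c \<le> d\<close> by simp
  \<comment> \<open>Extending by translations makes the image open, as \<open>continuous_onI_mono\<close> requires.\<close>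
  define h where "h t = (if t < c then a + (t - c) else if d < t then b + (t - d) else f t)" for t
  have "mono h"
  proof (rule monoI)
    fix s t :: real
    assume "s \<le> t"
    then show "h s \<le> h t"
      using le[of s t] range[of s] range[of t] \<open>a \<le> b\<close> \<open>c \<le> d\<close> by (auto simp: h_def)
  qed
  moreover have "range h = UNIV"
  proof -
    have "\<exists>t. h t = x" for x
    proof -
      consider "x < a" | "x > b" | "x \<in> {a..b}"
        by fastforce
      then show ?thesis
      proof cases
        case 1
        then show ?thesis by (intro exI[of _ "x - a + c"]) (simp add: h_def)
      next
        case 2
        then show ?thesis using \<open>c \<le> d\<close> by (intro exI[of _ "x - b + d"]) (simp add: h_def)
      next
        case 3
        then obtain t where "t \<in> {c..d}" "f t = x"
          using img by (metis imageE)
        then show ?thesis by (intro exI[of _ t]) (simp add: h_def)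
      qed
    qed
    then show ?thesis by (metis surjI)
  qed
  ultimately have "continuous_on UNIV h"
    by (intro continuous_onI_mono) (auto simp: mono_def)
  then have "continuous_on {c..d} h"
    by (rule continuous_on_subset) simp
  then show ?thesis
    by (rule continuous_on_eq) (simp add: h_def)
qed

lemma nat_div_two_bracket:
  fixes t :: real
  assumes "0 \<le> t" "t \<le> 1"
  obtains i :: nat where "i < 2 ^ n" "real i / 2 ^ n \<le> t" "t \<le> real (Suc i) / 2 ^ n"
proof (cases "t = 1")
  case True
  \<comment> \<open>At \<open>t = 1\<close> the floor would be \<open>2 ^ n\<close>, one past the
    last admissible cell, so the last cell is taken.\<close>
  show ?thesis
    using True by (intro that[of "2 ^ n - 1"]) (auto simp: of_nat_diff field_simps)
next
  case False
  define i where "i = nat \<lfloor>t * 2 ^ n\<rfloor>"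
  have i: "real i \<le> t * 2 ^ n" "t * 2 ^ n < real i + 1"
    using assms by (auto simp: i_def of_nat_nat)
  have "t * 2 ^ n < 2 ^ n"
    using False assms by simp
  with i(1) have "real i < 2 ^ n"
    by (rule order_le_less_trans)
  then have "i < 2 ^ n"
    by (metis of_nat_less_iff of_nat_numeral of_nat_power)
  with i show ?thesis
    by (intro that[of i]) (auto simp: field_simps)
qed

lemma eq_if_diff_le_inverse_power:
  fixes x y :: real
  assumes "\<And>n. \<bar>x - y\<bar> \<le> 1 / 2 ^ n"
  shows "x = y"
proof (rule ccontr)
  assume "x \<noteq> y"
  then obtain n where "(1 / 2) ^ n < \<bar>x - y\<bar>"
    using real_arch_pow_inv[of "\<bar>x - y\<bar>" "1 / 2"] by auto
  with assms[of n] show False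
    by (simp add: power_divide)
qed

section \<open>The hypotheses in pointwise form\<close>

locale bisymmetric_mean =
  fixes a b :: real and F :: "real \<Rightarrow> real \<Rightarrow> real"
  assumes less: "a < b"
    and maps: "maps_square_into {a..b} F"
    and refl: "reflexive_map_on {a..b} F"
    and mono: "partially_strict_mono_on {a..b} F"
    and symm: "symmetric_map_on {a..b} F"
    and bisymm: "bisymmetric_on {a..b} F"
begin

lemma F_closed: "x \<in> {a..b} \<Longrightarrow> y \<in> {a..b} \<Longrightarrow> F x y \<in> {a..b}"
  using maps unfolding maps_square_into_def by blast

lemma F_refl: "x \<in> {a..b} \<Longrightarrow> F x x = x"
  using refl unfolding reflexive_map_on_def by blast

lemma F_commute: "x \<in> {a..b} \<Longrightarrow> y \<in> {a..b} \<Longrightarrow> F x y = F y x"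
  using symm unfolding symmetric_map_on_def by blast

lemma F_bisymm:
  "x \<in> {a..b} \<Longrightarrow> y \<in> {a..b} \<Longrightarrow> u \<in> {a..b} \<Longrightarrow> v \<in> {a..b} \<Longrightarrow> F (F x y) (F u v) = F (F x u) (F y v)"
  using bisymm unfolding bisymmetric_on_def by blast

lemma F_less_right: "x \<in> {a..b} \<Longrightarrow> y \<in> {a..b} \<Longrightarrow> z \<in> {a..b} \<Longrightarrow> y < z \<Longrightarrow> F x y < F x z"
  using mono unfolding partially_strict_mono_on_def strict_mono_on_def by blast

lemma F_less_left: "x \<in> {a..b} \<Longrightarrow> y \<in> {a..b} \<Longrightarrow> z \<in> {a..b} \<Longrightarrow> y < z \<Longrightarrow> F y x < F z x"
  using mono unfolding partially_strict_mono_on_def strict_mono_on_def by blast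

lemma F_le:
  assumes "x \<in> {a..b}" "y \<in> {a..b}" "x' \<in> {a..b}" "y' \<in> {a..b}" "x \<le> x'" "y \<le> y'"
  shows "F x y \<le> F x' y'"
proof -
  have "F x y \<le> F x y'"
    using F_less_right[of x y y'] assms by (cases "y = y'") auto
  also have "\<dots> \<le> F x' y'"
    using F_less_left[of y' x x'] assms by (cases "x = x'") auto
  finally show ?thesis .
qed

section \<open>Dyadic values and their order\<close>

text \<open>\<open>dyad n k\<close> will be the value of the inverse of \<open>g\<close> at \<open>k / 2 ^ n\<close>; for \<open>k > 2 ^ n\<close> it is \<open>b\<close>.\<close>

primrec dyad :: "nat \<Rightarrow> nat \<Rightarrow> real" where
  "dyad 0 k = (if k = 0 then a else b)"
| "dyad (Suc n) k = F (dyad n (k div 2)) (dyad n (Suc k div 2))"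

lemma dyad_in: "dyad n k \<in> {a..b}"
proof (induction n arbitrary: k)
  case 0
  then show ?case using less by simp
next
  case (Suc n)
  then show ?case using F_closed by (simp del: atLeastAtMost_iff)
qed

text \<open>Induction on the level: both indices split into floor and ceiling halves, bisymmetry
  interchanges the two middle arguments, and the regrouped pairs fall under the induction
  hypothesis.\<close>

lemma F_dyad: "i \<le> 2 ^ n \<Longrightarrow> j \<le> 2 ^ n \<Longrightarrow> F (dyad n i) (dyad n j) = dyad (Suc n) (i + j)"
proof (induction n arbitrary: i j)
  case 0
  then have "i = 0 \<or> i = 1" "j = 0 \<or> j = 1"
    by auto
  then show ?case
    using less F_commute[of a b] by auto
next
  case (Suc n)
  \<comment> \<open>The halves of \<open>j\<close> come in the opposite order, so that for odd
    \<open>i\<close> and \<open>j\<close> both sums equal \<open>(i + j) div 2\<close>; pairing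
    floor with floor would give sums differing by two.\<close>
  define i1 i2 j1 j2 where ij: "i1 = i div 2" "i2 = Suc i div 2" "j1 = Suc j div 2" "j2 = j div 2"
  have bounds: "i1 \<le> 2 ^ n" "i2 \<le> 2 ^ n" "j1 \<le> 2 ^ n" "j2 \<le> 2 ^ n"
    using Suc.prems unfolding ij by auto
  have "F (dyad (Suc n) i) (dyad (Suc n) j)
      = F (F (dyad n i1) (dyad n i2)) (F (dyad n j1) (dyad n j2))"
    using F_commute[OF dyad_in dyad_in, of n j1 n j2] by (simp add: ij)
  also have "\<dots> = F (F (dyad n i1) (dyad n j1)) (F (dyad n i2) (dyad n j2))"
    by (intro F_bisymm dyad_in)
  also have "\<dots> = F (dyad (Suc n) (i1 + j1)) (dyad (Suc n) (i2 + j2))"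
    using bounds by (simp only: Suc.IH)
  also have "\<dots> = dyad (Suc (Suc n)) (i + j)"
  proof -
    consider "i1 + j1 = (i + j) div 2" "i2 + j2 = Suc (i + j) div 2"
      | "i2 + j2 = (i + j) div 2" "i1 + j1 = Suc (i + j) div 2"
      unfolding ij by (cases "even i"; cases "even j") (auto elim!: evenE oddE)
    then show ?thesis
    proof cases
      case 1
      then show ?thesis by (simp only: dyad.simps(2)[of "Suc n" "i + j"])
    next
      case 2
      then show ?thesis
        by (subst F_commute[OF dyad_in dyad_in]) (simp only: dyad.simps(2)[of "Suc n" "i + j"])
    qed
  qed
  finally show ?case .
qed

text \<open>At an even index both halves coincide, so reflexivity keeps the value. Hence the value
  depends only on the fraction \<open>k / 2 ^ n\<close>.\<close>

lemma dyad_refine: "dyad (n + m) (k * 2 ^ m) = dyad n k"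
proof (induction m)
  case (Suc m)
  have "dyad (n + Suc m) (k * 2 ^ Suc m) = F (dyad (n + m) (k * 2 ^ m)) (dyad (n + m) (k * 2 ^ m))"
    by (simp add: mult.left_commute[of k 2])
  then show ?case
    using F_refl[OF dyad_in] Suc by simp
qed simp

text \<open>Passing from \<open>k\<close> to \<open>Suc k\<close> raises exactly one of the two
  halves by one: the right one for even \<open>k\<close>, the left one for odd
  \<open>k\<close>.\<close>

lemma dyad_Suc_less: "k < 2 ^ n \<Longrightarrow> dyad n k < dyad n (Suc k)"
proof (induction n arbitrary: k)
  case 0
  then show ?case using less by simp
next
  case (Suc n)
  have bound: "k div 2 < 2 ^ n"
    using Suc.prems by auto
  note IH = Suc.IH[OF bound]
  show ?case
  proof (cases "even k")
    case True
    then have "Suc k div 2 = k div 2"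
      by presburger
    then show ?thesis
      using F_less_right[OF dyad_in dyad_in dyad_in IH, of n "k div 2"] by simp
  next
    case False
    then have "Suc k div 2 = Suc (k div 2)"
      by presburger
    then show ?thesis
      using F_less_left[OF dyad_in dyad_in dyad_in IH, of n "Suc (k div 2)"] by simp
  qed
qed

lemma dyad_less: "i < j \<Longrightarrow> j \<le> 2 ^ n \<Longrightarrow> dyad n i < dyad n j"
proof (induction j)
  case (Suc j)
  then show ?case
    using dyad_Suc_less[of j n] by (cases "i = j") (auto simp: less_Suc_eq_le)
qed simp

lemma dyad_le_iff:
  assumes "i \<le> 2 ^ n" "j \<le> 2 ^ m"
  shows "dyad n i \<le> dyad m j \<longleftrightarrow> real i / 2 ^ n \<le> real j / 2 ^ m"
proof -
  have bounds: "i * 2 ^ m \<le> 2 ^ (n + m)" "j * 2 ^ n \<le> 2 ^ (n + m)"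
    using assms by (auto simp: power_add mult.commute)
  \<comment> \<open>Both values move to the common denominator \<open>2 ^ (n + m)\<close>, where
    their order is that of the indices.\<close>
  have "dyad n i \<le> dyad m j \<longleftrightarrow> dyad (n + m) (i * 2 ^ m) \<le> dyad (n + m) (j * 2 ^ n)"
    using dyad_refine[of n m i] dyad_refine[of m n j] by (simp add: add.commute)
  also have "\<dots> \<longleftrightarrow> i * 2 ^ m \<le> j * 2 ^ n"
    using dyad_less[OF _ bounds(1)] dyad_less[OF _ bounds(2)]
    by (metis linorder_not_le order_le_less)
  also have "\<dots> \<longleftrightarrow> real (i * 2 ^ m) \<le> real (j * 2 ^ n)"
    by (simp only: of_nat_le_iff)
  also have "\<dots> \<longleftrightarrow> real i / 2 ^ n \<le> real j / 2 ^ m"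
    by (simp add: field_simps)
  finally show ?thesis .
qed

lemma dyad_bracket:
  assumes "x \<in> {a..b}"
  obtains i where "i < 2 ^ n" "dyad n i \<le> x" "x \<le> dyad n (Suc i)"
proof -
  have ends: "dyad n 0 = a" "dyad n (2 ^ n) = b"
    using dyad_refine[of 0 n 0] dyad_refine[of 0 n 1] by auto
  define k where "k = (LEAST k. x \<le> dyad n k)"
  have x_le: "x \<le> dyad n (2 ^ n)"
    using ends assms by simp
  then have k: "x \<le> dyad n k" "k \<le> 2 ^ n"
    unfolding k_def by (fact LeastI, fact Least_le)
  show thesis
  proof (cases k)
    \<comment> \<open>Here \<open>x = a\<close>, which belongs to the first cell.\<close>
    case 0
    then show ?thesis
      using that[of 0] k ends assms dyad_Suc_less[of 0 n] by auto
  next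
    case (Suc i)
    then have "\<not> x \<le> dyad n i"
      unfolding k_def by (intro not_less_Least) simp
    then show ?thesis
      using that[of i] k Suc by auto
  qed
qed

section \<open>The dyadic coordinate and its mean equation\<close>

definition g :: "real \<Rightarrow> real" where
  "g x = Sup {real k / 2 ^ n | n k. k \<le> 2 ^ n \<and> dyad n k \<le> x}"

lemma g_ge:
  assumes "k \<le> 2 ^ n" "dyad n k \<le> x"
  shows "real k / 2 ^ n \<le> g x"
  unfolding g_def
proof (rule cSup_upper)
  show "bdd_above {real k / 2 ^ n | n k. k \<le> 2 ^ n \<and> dyad n k \<le> x}"
  proof (rule bdd_aboveI[where M = 1])
    fix r
    assume "r \<in> {real k / 2 ^ n | n k. k \<le> 2 ^ n \<and> dyad n k \<le> x}"
    then obtain n k where "r = real k / 2 ^ n" "real k \<le> real (2 ^ n)"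
      by (auto simp only: of_nat_le_iff)
    then show "r \<le> 1"
      by simp
  qed
qed (use assms in auto)

lemma g_le:
  assumes "k \<le> 2 ^ n" "x \<le> dyad n k" "a \<le> x"
  shows "g x \<le> real k / 2 ^ n"
  unfolding g_def
proof (rule cSup_least)
  \<comment> \<open>Index 0 has value \<open>a\<close>, so \<open>a \<le> x\<close> keeps the
    supremum from being taken over the empty set.\<close>
  show "{real k / 2 ^ n | n k. k \<le> 2 ^ n \<and> dyad n k \<le> x} \<noteq> {}"
    using assms(3) by (auto intro!: exI[of _ 0])
next
  fix r
  assume "r \<in> {real k / 2 ^ n | n k. k \<le> 2 ^ n \<and> dyad n k \<le> x}"
  then obtain m j where j: "r = real j / 2 ^ m" "j \<le> 2 ^ m" "dyad m j \<le> x"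
    by auto
  then have "dyad m j \<le> dyad n k"
    using assms by simp
  then show "r \<le> real k / 2 ^ n"
    using dyad_le_iff j assms by simp
qed

lemma g_in: "x \<in> {a..b} \<Longrightarrow> g x \<in> {0..1}"
  using g_ge[of 0 0 x] g_le[of 1 0 x] by auto

text \<open>If \<open>x\<close> and \<open>y\<close> lie in cells \<open>i\<close> and
  \<open>j\<close> of level \<open>n\<close>, both sides lie between
  \<open>(i + j) / 2 ^ Suc n\<close> and \<open>(i + j + 2) / 2 ^ Suc n\<close>, hence within
  \<open>1 / 2 ^ n\<close> of each other.\<close>

lemma g_F:
  assumes x: "x \<in> {a..b}" and y: "y \<in> {a..b}"
  shows "g (F x y) = (g x + g y) / 2"
proof (rule eq_if_diff_le_inverse_power)
  fix n
  obtain i where i: "i < 2 ^ n" "dyad n i \<le> x" "x \<le> dyad n (Suc i)"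
    using dyad_bracket[OF x] .
  obtain j where j: "j < 2 ^ n" "dyad n j \<le> y" "y \<le> dyad n (Suc j)"
    using dyad_bracket[OF y] .
  have "dyad (Suc n) (i + j) \<le> F x y"
    using F_dyad[of i n j] F_le[OF dyad_in dyad_in x y i(2) j(2)] i j
    by (simp del: dyad.simps)
  then have lower: "real (i + j) / 2 ^ Suc n \<le> g (F x y)"
    using i j by (intro g_ge) (auto simp del: dyad.simps)
  have "F x y \<le> dyad (Suc n) (Suc i + Suc j)"
    using F_dyad[of "Suc i" n "Suc j"] F_le[OF x y dyad_in dyad_in i(3) j(3)] i j
    by (simp del: dyad.simps)
  then have upper: "g (F x y) \<le> real (Suc i + Suc j) / 2 ^ Suc n"
    using i j F_closed[OF x y] by (intro g_le) (auto simp del: dyad.simps)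
  have "real i / 2 ^ n \<le> g x" "g x \<le> real (Suc i) / 2 ^ n"
    using i x by (auto intro!: g_ge g_le simp del: of_nat_Suc)
  moreover have "real j / 2 ^ n \<le> g y" "g y \<le> real (Suc j) / 2 ^ n"
    using j y by (auto intro!: g_ge g_le simp del: of_nat_Suc)
  ultimately show "\<bar>g (F x y) - (g x + g y) / 2\<bar> \<le> 1 / 2 ^ n"
    using lower upper by (simp add: add_divide_distrib abs_le_iff)
qed

lemma g_mono:
  assumes x: "x \<in> {a..b}" and y: "y \<in> {a..b}" and "x \<le> y"
  shows "g x \<le> g y"
proof (rule field_le_epsilon)
  fix e :: real
  assume "0 < e"
  then obtain n where n: "(1 / 2) ^ n < e"
    using real_arch_pow_inv[of e "1 / 2"] by auto
  obtain i where i: "i < 2 ^ n" "dyad n i \<le> x" "x \<le> dyad n (Suc i)"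
    using dyad_bracket[OF x] .
  have "g x \<le> real (Suc i) / 2 ^ n"
    using i x by (intro g_le) auto
  moreover have "real i / 2 ^ n \<le> g y"
    using i \<open>x \<le> y\<close> by (intro g_ge) auto
  ultimately show "g x \<le> g y + e"
    using n by (simp add: add_divide_distrib power_divide)
qed

lemma g_surj:
  assumes t: "t \<in> {0..1}"
  obtains x where "x \<in> {a..b}" "g x = t"
proof -
  \<comment> \<open>The preimage of \<open>t\<close> is the supremum of the dyadic values with index
    at most \<open>t\<close>. At each level it is trapped between the two dyadic values whose
    indices enclose \<open>t\<close>.\<close>
  define A where "A = {dyad n k | n k. k \<le> 2 ^ n \<and> real k / 2 ^ n \<le> t}"
  have A_sub: "A \<subseteq> {a..b}"
    using dyad_in by (auto simp: A_def simp del: atLeastAtMost_iff)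
  then have bdd: "bdd_above A"
    by (meson bdd_above_Icc bdd_above_mono)
  have "a \<in> A"
    unfolding A_def using t by (auto intro!: exI[of _ 0])
  define x where "x = Sup A"
  have x: "x \<in> {a..b}"
    using cSup_upper[OF \<open>a \<in> A\<close> bdd] cSup_least[of A b] A_sub \<open>a \<in> A\<close>
    by (force simp: x_def)
  have "g x = t"
  proof (rule eq_if_diff_le_inverse_power)
    fix n
    obtain i where i: "i < 2 ^ n" "real i / 2 ^ n \<le> t" "t \<le> real (Suc i) / 2 ^ n"
      using nat_div_two_bracket[of t n] t by auto
    have "dyad n i \<le> x"
      unfolding x_def using i less_imp_le by (intro cSup_upper bdd) (unfold A_def, blast)
    then have "real i / 2 ^ n \<le> g x"
      using i by (intro g_ge) auto
    moreover have "x \<le> dyad n (Suc i)"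
      unfolding x_def
    proof (rule cSup_least)
      fix y
      assume "y \<in> A"
      then obtain m k where k: "y = dyad m k" "k \<le> 2 ^ m" "real k / 2 ^ m \<le> t"
        by (auto simp: A_def)
      have "real k / 2 ^ m \<le> real (Suc i) / 2 ^ n"
        using k(3) i(3) by (rule order_trans)
      then show "y \<le> dyad n (Suc i)"
        using k i dyad_le_iff[of k m "Suc i" n] by simp
    qed (use \<open>a \<in> A\<close> in auto)
    then have "g x \<le> real (Suc i) / 2 ^ n"
      using i x by (intro g_le) auto
    ultimately show "\<bar>g x - t\<bar> \<le> 1 / 2 ^ n"
      using i by (simp add: add_divide_distrib abs_le_iff)
  qed
  with x show thesis
    by (rule that)
qed

section \<open>Injectivity by a countability argument\<close>

lemma g_neq:
  assumes x: "x \<in> {a..b}" and y: "y \<in> {a..b}" and "x < y"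
  shows "g x \<noteq> g y"
proof
  assume eq: "g x = g y"
  \<comment> \<open>This map solves \<open>g q = (s + g x) / 2\<close> for \<open>s\<close>,
    recovering \<open>s = g z\<close> from any rational \<open>q\<close> between
    \<open>F z x\<close> and \<open>F z y\<close>.\<close>
  have "{0..1} \<subseteq> (\<lambda>q. 2 * g q - g x) ` \<rat>"
  proof
    fix s :: real
    assume "s \<in> {0..1}"
    then obtain z where z: "z \<in> {a..b}" "g z = s"
      by (rule g_surj)
    obtain q where q: "q \<in> \<rat>" "F z x < q" "q < F z y"
      using Rats_dense_in_real[OF F_less_right[OF z(1) x y \<open>x < y\<close>]] by blast
    have "q \<in> {a..b}"
      using q F_closed[OF z(1) x] F_closed[OF z(1) y] by simp
    then have "g (F z x) \<le> g q" "g q \<le> g (F z y)"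
      using q by (simp_all only: g_mono F_closed z x y less_imp_le)
    then have "g q = (s + g x) / 2"
      using g_F[OF z(1) x] g_F[OF z(1) y] z eq by simp
    then have "s = 2 * g q - g x"
      by simp
    then show "s \<in> (\<lambda>q. 2 * g q - g x) ` \<rat>"
      using q by blast
  qed
  then have "countable {0..1::real}"
    by (rule countable_subset) (simp add: countable_rat)
  then show False
    using uncountable_closed_interval[of 0 "1::real"] by simp
qed

lemma g_bij: "bij_betw g {a..b} {0..1}"
proof (rule bij_betw_imageI)
  show "inj_on g {a..b}"
    using g_neq by (metis inj_onI linorder_neqE)
  show "g ` {a..b} = {0..1}"
    using g_in g_surj by (blast elim: g_surj)
qed

end

section \<open>Passing to the inverse function\<close>

theorem theorem8:
  fixes a b :: real and F :: "real \<Rightarrow> real \<Rightarrow> real"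
  assumes "a < b"
    and "maps_square_into {a..b} F"
    and "reflexive_map_on {a..b} F"
    and "partially_strict_mono_on {a..b} F"
    and "symmetric_map_on {a..b} F"
    and "bisymmetric_on {a..b} F"
  shows "\<exists>f :: real \<Rightarrow> real. continuous_on {0..1} f \<and> bij_betw f {0..1} {a..b} \<and>
    (\<forall>x\<in>{a..b}. \<forall>y\<in>{a..b}.
       F x y = f ((inv_into {0..1} f x + inv_into {0..1} f y) / 2))"
proof -
  interpret bisymmetric_mean a b F
    using assms by unfold_locales
  define f where "f = inv_into {a..b} g"
  have bij: "bij_betw f {0..1} {a..b}"
    unfolding f_def by (rule bij_betw_inv_into[OF g_bij])
  have gf: "g (f t) = t" if "t \<in> {0..1}" for t
    using bij_betw_inv_into_right[OF g_bij that] by (simp add: f_def)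
  have fg: "f (g x) = x" if "x \<in> {a..b}" for x
    using bij_betw_inv_into_left[OF g_bij that] by (simp add: f_def)
  have f_in: "f t \<in> {a..b}" if "t \<in> {0..1}" for t
    using bij that by (rule bij_betw_apply)
  have "strict_mono_on {0..1} f"
  proof (rule strict_mono_onI)
    fix s t :: real
    assume st: "s \<in> {0..1}" "t \<in> {0..1}" "s < t"
    show "f s < f t"
    proof (rule ccontr)
      assume "\<not> f s < f t"
      \<comment> \<open>Since \<open>g\<close> undoes \<open>f\<close>, this says
        \<open>t \<le> s\<close>.\<close>
      then have "g (f t) \<le> g (f s)"
        using st f_in by (intro g_mono) auto
      then show False
        using st gf by simp
    qed
  qed
  then have "continuous_on {0..1} f"
    using bij by (rule strict_mono_on_bij_betw_imp_continuous_on) simp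
  moreover have "F x y = f ((inv_into {0..1} f x + inv_into {0..1} f y) / 2)"
    if x: "x \<in> {a..b}" and y: "y \<in> {a..b}" for x y
  proof -
    \<comment> \<open>On \<open>{a..b}\<close> the inverse of \<open>f\<close> is \<open>g\<close>
      again, so the mean equation for \<open>g\<close> becomes the claimed formula.\<close>
    have inv: "inv_into {0..1} f z = g z" if "z \<in> {a..b}" for z
      using bij_betw_imp_inj_on[OF bij] g_in[OF that] fg[OF that] by (rule inv_into_f_eq)
    have "F x y = f (g (F x y))"
      using fg[OF F_closed[OF x y]] by simp
    then show ?thesis
      by (simp add: g_F[OF x y] inv x y del: atLeastAtMost_iff)
  qed
  ultimately show ?thesis
    using bij by blast
qed

end
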